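(* Let $\mathbb{K}$ be a field and let $I$ be a monomial ideal of the polynomial ring $R=\mathbb{K}[x_1,\ldots,x_n]$ whose minimal set of monomial generators is $G(I)=\{x^{\mathbf{e}_1},\ldots,x^{\mathbf{e}_k}\}$ with $k\ge 1$, where $\mathbf{e}_j=(e_{j_1},\ldots,e_{j_n})\in\mathbb{N}_0^n$ for $j=1,\ldots,k$. Define $\mathbf{m}=(m_1,\ldots,m_n)$ by $m_i:=\max\{e_{1_i},\ldots,e_{k_i}\}$, the largest power of $x_i$ occurring in a generator in $G(I)$. For $S\subseteq[n]$, define the vector $\mathbf{m}(S)\in\mathbb{N}_0^n$ entry-wise by $$\mathbf{m}(S)_i:=\begin{cases} m_i & i\in S,\\ 0 & i\notin S,\end{cases}$$ and define the ideal $$I_S:=(I:x^{\mathbf{m}(S)})+\langle x_i^{m_i} : i\in[n],\ i\notin S\rangle .$$ Then $$I=\bigcap_{S\subsetneq[n]} I_S,$$ where the intersection is over all proper subsets $S$ of $[n]$ (including $S=\emptyset$), and each ideal $I_S$ in the intersection is either primary or the unit ideal $R$.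
   Context: Notation: $[n]:=\{1,\ldots,n\}$ and $\mathbb{N}_0$ is the set of nonnegative integers. For $\mathbf{a}=(a_1,\ldots,a_n)\in\mathbb{N}_0^n$, $x^{\mathbf{a}}:=x_1^{a_1}\cdots x_n^{a_n}$. A monomial ideal of $R$ is an ideal generated by finitely many monomials in $x_1,\ldots,x_n$; $G(I)$ denotes its (unique) minimal set of monomial generators. The entry $e_{j_i}$ is the $i$-th entry of the exponent vector $\mathbf{e}_j$. For an ideal $I$ and $f\in R$, $(I:f):=\{g\in R : gf\in I\}$. By convention $x_i^0=1$. An ideal $Q$ of $R$ is primary if $Q\neq R$ and, whenever $a,b\in R$ satisfy $ab\in Q$ and $a\notin Q$, then $b\in\sqrt{Q}$. *)

theory Defs
  imports Complex_Main "HOL-Library.Poly_Mapping" "HOL-Library.Set_Algebras"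
begin

(* The polynomial ring in finitely many variables x_i (i :: 'n, with 'n a finite type playing the
   role of [n]) over 'k.  Keys are exponent vectors, values are coefficients; the ring structure
   of Poly_Mapping is convolution. *)
type_synonym ('n, 'k) mpol = "('n \<Rightarrow>\<^sub>0 nat) \<Rightarrow>\<^sub>0 'k"

definition xvar :: "'n \<Rightarrow> ('n, 'k::comm_ring_1) mpol" where
  "xvar i = Poly_Mapping.single (Poly_Mapping.single i 1) 1"

definition xpow :: "('n::finite \<Rightarrow> nat) \<Rightarrow> ('n, 'k::comm_ring_1) mpol" where
  "xpow a = (\<Prod>i\<in>UNIV. xvar i ^ a i)"

(* Ideals of a commutative ring are the submodules of the ring regarded as a module over itself. *)
lemma module_times: "module ((*) :: 'a::comm_ring_1 \<Rightarrow> 'a \<Rightarrow> 'a)"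
  by unfold_locales (simp_all add: algebra_simps)

definition is_ideal :: "'a::comm_ring_1 set \<Rightarrow> bool" where
  "is_ideal = module.subspace (*)"

definition ideal_gen :: "'a::comm_ring_1 set \<Rightarrow> 'a set" where
  "ideal_gen = module.span (*)"

definition colon :: "'a::comm_ring_1 set \<Rightarrow> 'a \<Rightarrow> 'a set" where
  "colon I f = {g. g * f \<in> I}"

definition radical :: "'a::comm_ring_1 set \<Rightarrow> 'a set" where
  "radical I = {f. \<exists>r>0. f ^ r \<in> I}"

definition primary_ideal :: "'a::comm_ring_1 set \<Rightarrow> bool" where
  "primary_ideal Q \<longleftrightarrow> is_ideal Q \<and> Q \<noteq> UNIV \<and>
     (\<forall>a b. a * b \<in> Q \<and> a \<notin> Q \<longrightarrow> b \<in> radical Q)"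

definition monomial_ideal :: "('n::finite, 'k::comm_ring_1) mpol set \<Rightarrow> bool" where
  "monomial_ideal I \<longleftrightarrow> (\<exists>M. finite M \<and> M \<subseteq> range xpow \<and> I = ideal_gen M)"

definition minimal_monomial_gens ::
  "('n::finite, 'k::comm_ring_1) mpol set \<Rightarrow> ('n, 'k) mpol set \<Rightarrow> bool" where
  "minimal_monomial_gens I G \<longleftrightarrow>
     G \<subseteq> range xpow \<and> ideal_gen G = I \<and> (\<forall>G'. G' \<subset> G \<longrightarrow> ideal_gen G' \<noteq> I)"

definition restr :: "('n \<Rightarrow> nat) \<Rightarrow> 'n set \<Rightarrow> 'n \<Rightarrow> nat" where
  "restr m S = (\<lambda>i. if i \<in> S then m i else 0)"

(* The outer plus is elementwise addition of sets, i.e. the sum of the two ideals. *)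
definition component ::
  "('n::finite, 'k::comm_ring_1) mpol set \<Rightarrow> ('n \<Rightarrow> nat) \<Rightarrow> 'n set \<Rightarrow> ('n, 'k) mpol set" where
  "component I m S = colon I (xpow (restr m S)) + ideal_gen {xvar i ^ m i | i. i \<notin> S}"

end

theory Submission
  imports Defs
begin

text \<open>
  Every ideal in the theorem is spanned, as a vector space, by the monomials that it contains: it
  has the form \<^term>\<open>{f. Poly_Mapping.keys f \<subseteq> U}\<close> for a set \<open>U\<close> of exponent vectors that is
  closed under addition of arbitrary exponents. For a monomial ideal with generator exponents \<open>E\<close>,
  the set \<open>U\<close> consists of the multiples of elements of \<open>E\<close> (\<open>ideal_gen_monomials\<close>). Colons by
  monomials become translations of \<open>U\<close>, sums become unions and intersections become intersections,
  so the theorem splits into a combinatorial claim about exponents and a criterion for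
  primariness.

  For the intersection, \<open>I \<subseteq> I_S\<close> is immediate. Conversely, let \<open>x^t\<close> lie in all \<open>I_S\<close>, and take
  \<open>S = {i. m i \<le> t i}\<close>. If \<open>S\<close> is everything, every generator divides \<open>x^t\<close>. Otherwise \<open>x^t\<close> is
  not divisible by any of the added powers \<open>x_i^(m i)\<close> with \<open>i \<notin> S\<close>, so a generator divides
  \<open>x^t * x^(m(S))\<close>; since its exponents on \<open>S\<close> are bounded by \<open>m\<close>, hence by \<open>t\<close>, it already divides
  \<open>x^t\<close> (\<open>multiples_eq_Inter\<close>).

  For primariness, membership of \<open>x^t\<close> in \<open>I_S\<close> depends only on the coordinates of \<open>t\<close> outside \<open>S\<close>,
  and \<open>I_S\<close> contains a power of each variable outside \<open>S\<close>. A proper ideal of this kind is primary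
  (\<open>primary_supported_in\<close>): given \<open>f * g\<close> in the ideal with \<open>f\<close> not in it, a term of \<open>g\<close> free of the
  variables outside \<open>S\<close> would combine with a term of \<open>f\<close> outside the ideal, of least degree in
  these variables, to a term of \<open>f * g\<close> outside the ideal. Hence all terms of \<open>g\<close> involve these
  variables, and a power of \<open>g\<close> lies in the ideal. That some such term does not cancel
  is a convexity argument (\<open>ex_unique_sum\<close>), which spares the choice of a monomial order.
\<close>

section \<open>Monomial ideals as sets of exponents\<close>

abbreviation "lookup \<equiv> Poly_Mapping.lookup"
abbreviation "keys \<equiv> Poly_Mapping.keys"
abbreviation "single \<equiv> Poly_Mapping.single"

definition supported_in :: "('n \<Rightarrow>\<^sub>0 nat) set \<Rightarrow> ('n, 'k::comm_ring_1) mpol set" where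
  "supported_in U = {f. keys f \<subseteq> U}"

definition exponent :: "('n::finite \<Rightarrow> nat) \<Rightarrow> 'n \<Rightarrow>\<^sub>0 nat" where
  "exponent a = Abs_poly_mapping a"

lemma lookup_exponent [simp]: "lookup (exponent a) i = a i"
  by (simp add: exponent_def)

definition multiples :: "('n \<Rightarrow> nat) set \<Rightarrow> ('n \<Rightarrow>\<^sub>0 nat) set" where
  "multiples E = {t. \<exists>a\<in>E. \<forall>i. a i \<le> lookup t i}"

definition up_closed :: "('n \<Rightarrow>\<^sub>0 nat) set \<Rightarrow> bool" where
  "up_closed U \<longleftrightarrow> (\<forall>t\<in>U. \<forall>s. t + s \<in> U)"

lemma xvar_power: "xvar i ^ r = single (single i r) 1"
  by (induction r) (simp_all add: xvar_def mult_single single_add[symmetric])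

lemma prod_single_one:
  "finite A \<Longrightarrow> (\<Prod>i\<in>A. single (h i) (1::'k::comm_ring_1))
    = single (\<Sum>i\<in>A. h i) 1"
  by (induction A rule: finite_induct) (simp_all add: mult_single)

lemma xpow_eq_single: "xpow a = single (exponent a) 1"
proof -
  have "(\<Sum>i\<in>UNIV. single i (a i)) = exponent a"
    by (rule poly_mapping_eqI) (simp add: lookup_sum lookup_single when_def)
  then show ?thesis
    by (simp add: xpow_def xvar_power prod_single_one)
qed

lemma xvar_power_eq_xpow: "xvar i ^ r = xpow (\<lambda>j. if j = i then r else 0)"
proof -
  have "single i r = exponent (\<lambda>j. if j = i then r else 0)"
    by (rule poly_mapping_eqI) (simp add: lookup_single when_def)
  then show ?thesis
    by (simp add: xvar_power xpow_eq_single)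
qed

lemma sum_of_terms: "(\<Sum>t\<in>keys f. single t (lookup f t)) = f"
  by (rule poly_mapping_eqI)
    (simp add: lookup_sum lookup_single when_def in_keys_iff)

lemma supported_in_Int: "supported_in (\<Inter>S\<in>\<A>. U S) = (\<Inter>S\<in>\<A>. supported_in (U S))"
  by (auto simp: supported_in_def)

lemma supported_in_UNIV: "supported_in UNIV = UNIV"
  by (simp add: supported_in_def)

lemma is_ideal_supported_in:
  assumes "up_closed U"
  shows "is_ideal (supported_in U)"
proof -
  interpret module "(*) :: ('a, 'b) mpol \<Rightarrow> _ \<Rightarrow> _"
    by (rule module_times)
  show ?thesis
    unfolding is_ideal_def
  proof (rule subspaceI)
    fix c x :: "('a, 'b) mpol"
    assume "x \<in> supported_in U"
    then have "keys (x * c) \<subseteq> U"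
      using keys_mult[of x c] assms by (fastforce simp: supported_in_def up_closed_def)
    then show "c * x \<in> supported_in U"
      by (simp add: supported_in_def mult.commute)
  qed (use keys_add in \<open>fastforce simp: supported_in_def\<close>)+
qed

text \<open>Sorting the terms of a polynomial by their exponents splits it into a part supported in
  \<open>U\<close> and a part supported in \<open>V\<close>, whence the nontrivial inclusion.\<close>
lemma supported_in_Un:
  "supported_in U + supported_in V = (supported_in (U \<union> V) :: ('n, 'k::comm_ring_1) mpol set)"
proof
  show "supported_in U + supported_in V \<subseteq> (supported_in (U \<union> V) :: ('n, 'k) mpol set)"
    using keys_add by (fastforce simp: supported_in_def elim!: set_plus_elim)
  show "(supported_in (U \<union> V) :: ('n, 'k) mpol set) \<subseteq> supported_in U + supported_in V"
  proof
    fix f :: "('n, 'k) mpol"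
    assume "f \<in> supported_in (U \<union> V)"
    then have f: "keys f \<subseteq> U \<union> V"
      by (simp add: supported_in_def)
    define part where
      "part A = (\<Sum>t\<in>A. single t (lookup f t))" for A
    have keys_part: "keys (part A) \<subseteq> A" for A
      using keys_sum[of "\<lambda>t. single t (lookup f t)" A]
      by (auto simp: part_def split: if_splits)
    have "f = part (keys f \<inter> U) + part (keys f - U)"
      unfolding part_def by (subst sum.Int_Diff[symmetric]) (simp_all add: sum_of_terms)
    moreover have "part (keys f \<inter> U) \<in> supported_in U"
      "part (keys f - U) \<in> supported_in V"
      using keys_part[of "keys f \<inter> U"] keys_part[of "keys f - U"] f
      by (auto simp: supported_in_def)
    ultimately show "f \<in> supported_in U + supported_in V"
      by (metis set_plus_intro)
  qed
qed

text \<open>The right-hand side is an ideal containing the generators; conversely each term of a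
  polynomial in it is a multiple of a generator.\<close>
lemma ideal_gen_monomials:
  "ideal_gen (xpow ` E) = (supported_in (multiples E) :: ('n::finite, 'k::comm_ring_1) mpol set)"
proof -
  interpret module "(*) :: ('n, 'k) mpol \<Rightarrow> _ \<Rightarrow> _"
    by (rule module_times)
  have "up_closed (multiples E)"
    unfolding up_closed_def multiples_def by (auto simp: lookup_add) (meson trans_le_add1)
  then have "subspace (supported_in (multiples E) :: ('n, 'k) mpol set)"
    using is_ideal_supported_in unfolding is_ideal_def by blast
  then have "span (xpow ` E) \<subseteq> (supported_in (multiples E) :: ('n, 'k) mpol set)"
    by (intro span_minimal) (auto simp: supported_in_def multiples_def xpow_eq_single)
  moreover have "f \<in> span (xpow ` E)" if "f \<in> supported_in (multiples E)" for f :: "('n, 'k) mpol"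
  proof -
    have "single t c \<in> span (xpow ` E)" if "t \<in> multiples E" for t and c :: 'k
    proof -
      from that obtain a where a: "a \<in> E" "\<And>i. a i \<le> lookup t i"
        by (auto simp: multiples_def)
      have "t - exponent a + exponent a = t"
        by (rule poly_mapping_eqI) (simp add: lookup_add lookup_minus a)
      then have "single t c = single (t - exponent a) c * xpow a"
        by (simp add: xpow_eq_single mult_single)
      also have "\<dots> \<in> span (xpow ` E)"
        using a by (intro span_scale span_base) auto
      finally show ?thesis .
    qed
    then have "(\<Sum>t\<in>keys f. single t (lookup f t)) \<in> span (xpow ` E)"
      using that by (intro span_sum) (auto simp: supported_in_def)
    then show ?thesis
      by (simp add: sum_of_terms)
  qed
  ultimately show ?thesis
    unfolding ideal_gen_def by blast
qed

text \<open>If \<open>a + b\<close> arises in only one way from the supports of the two factors, the convolution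
  sum for its coefficient has a single term, so no cancellation can occur.\<close>
lemma lookup_mult_unique_sum:
  fixes f g :: "('n, 'k::comm_ring_1) mpol"
  assumes "\<And>a' b'. \<lbrakk>a' \<in> keys f; b' \<in> keys g; a' + b' = a + b\<rbrakk>
    \<Longrightarrow> a' = a"
  shows "lookup (f * g) (a + b) = lookup f a * lookup g b"
proof -
  have "lookup f l * (\<Sum>q. lookup g q when a + b = l + q) = (lookup f a * lookup g b when l = a)" for l
  proof (cases "l = a")
    case True
    then show ?thesis
      by (simp add: when_def)
  next
    case False
    then have "lookup f l * (lookup g q when a + b = l + q) = 0" for q
      using assms[of l q] by (cases "lookup f l = 0"; cases "lookup g q = 0") (auto simp: when_def in_keys_iff)
    moreover have "finite {q. (lookup g q when a + b = l + q) \<noteq> 0}"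
      by (rule finite_subset[OF _ finite_keys[of g]]) (auto simp: in_keys_iff)
    ultimately show ?thesis
      using False by (simp add: Sum_any_right_distrib)
  qed
  then show ?thesis
    by (simp add: lookup_mult)
qed

lemma colon_monomial:
  "colon (supported_in U) (xpow b) = (supported_in {t. t + exponent b \<in> U} ::
    ('n::finite, 'k::comm_ring_1) mpol set)"
proof -
  have "keys (g * xpow b) = (\<lambda>t. t + exponent b) ` keys g"
    for g :: "('n, 'k) mpol"
  proof
    show "keys (g * xpow b) \<subseteq> (\<lambda>t. t + exponent b) ` keys g"
      using keys_mult[of g "xpow b"] by (auto simp: xpow_eq_single)
    have "lookup (g * xpow b) (t + exponent b) = lookup g t" for t
      by (subst lookup_mult_unique_sum) (auto simp: xpow_eq_single)
    then show "(\<lambda>t. t + exponent b) ` keys g \<subseteq> keys (g * xpow b)"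
      by (auto simp: in_keys_iff)
  qed
  then show ?thesis
    by (auto simp: colon_def supported_in_def)
qed

section \<open>Primary monomial ideals\<close>

text \<open>A substitute for leading terms, without an order on the variables: choose \<open>a\<close> and \<open>b\<close> so
  that \<open>a + b\<close> has maximal Euclidean norm. If also \<open>a' + b' = a + b\<close>, then \<open>a + b\<close> is the
  midpoint of \<open>a + b'\<close> and \<open>a' + b\<close>, whose norms are not larger; strict convexity forces the three
  vectors to coincide.\<close>
lemma ex_unique_sum:
  fixes A B :: "('n::finite \<Rightarrow>\<^sub>0 nat) set"
  assumes "finite A" "finite B" "A \<noteq> {}" "B \<noteq> {}"
  obtains a b where "a \<in> A" "b \<in> B"
    "\<And>a' b'. \<lbrakk>a' \<in> A; b' \<in> B; a' + b' = a + b\<rbrakk> \<Longrightarrow> a' = a"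
proof -
  define q where "q t = (\<Sum>i\<in>UNIV. (int (lookup t i))\<^sup>2)" for t :: "'n \<Rightarrow>\<^sub>0 nat"
  define P where "P = (\<lambda>(a, b). a + b) ` (A \<times> B)"
  have P: "finite P" "P \<noteq> {}"
    using assms by (auto simp: P_def)
  then have "Max (q ` P) \<in> q ` P"
    by simp
  then obtain s where "s \<in> P" "q s = Max (q ` P)"
    by auto
  with P(1) have s: "s \<in> P" "\<And>t. t \<in> P \<Longrightarrow> q t \<le> q s"
    by auto
  then obtain a b where ab: "a \<in> A" "b \<in> B" "s = a + b"
    by (auto simp: P_def)
  have "a' = a" if "a' \<in> A" "b' \<in> B" "a' + b' = a + b" for a' b'
  proof -
    have "a + b' \<in> P" "a' + b \<in> P"
      using ab that by (auto simp: P_def)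
    then have "q (a + b') + q (a' + b) \<le> 2 * q s"
      using s(2)[of "a + b'"] s(2)[of "a' + b"] by simp
    have coord: "lookup a' i + lookup b' i = lookup a i + lookup b i" for i
      using that(3) by (metis lookup_add)
    \<comment> \<open>The parallelogram law about the midpoint \<^term>\<open>s\<close>; both ends differ from it by \<open>a' - a\<close>
      up to sign.\<close>
    have "q (a + b') + q (a' + b)
      = 2 * q s + 2 * (\<Sum>i\<in>UNIV. (int (lookup a' i) - int (lookup a i))\<^sup>2)"
    proof -
      have "(int (lookup (a + b') i))\<^sup>2 + (int (lookup (a' + b) i))\<^sup>2
        = 2 * (int (lookup (a + b) i))\<^sup>2 + 2 * (int (lookup a' i) - int (lookup a i))\<^sup>2" for i
      proof -
        have b': "int (lookup b' i) = int (lookup a i) + int (lookup b i) - int (lookup a' i)"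
          using coord[of i] by linarith
        show ?thesis
          unfolding lookup_add of_nat_add b' by algebra
      qed
      then show ?thesis
        unfolding q_def ab(3) sum_distrib_left sum.distrib[symmetric] by (intro sum.cong) auto
    qed
    with \<open>q (a + b') + q (a' + b) \<le> 2 * q s\<close>
    have "(\<Sum>i\<in>UNIV. (int (lookup a' i) - int (lookup a i))\<^sup>2) = 0"
      by (smt (verit) sum_nonneg zero_le_power2)
    then have "int (lookup a' i) = int (lookup a i)" for i
      by (simp add: sum_nonneg_eq_0_iff)
    then show ?thesis
      by (intro poly_mapping_eqI) simp
  qed
  with ab show thesis
    using that by blast
qed

lemma keys_power_weight:
  fixes g :: "('n::finite, 'k::comm_ring_1) mpol"
  assumes "\<And>t. t \<in> keys g \<Longrightarrow> 0 < (\<Sum>i\<in>T. lookup t i)"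
  shows "t \<in> keys (g ^ r) \<Longrightarrow> r \<le> (\<Sum>i\<in>T. lookup t i)"
proof (induction r arbitrary: t)
  case (Suc r)
  then obtain a b where "t = a + b" "a \<in> keys g" "b \<in> keys (g ^ r)"
    using keys_mult[of g "g ^ r"] by auto
  then show ?case
    using assms[of a] Suc.IH[of b] by (simp add: lookup_add sum.distrib)
qed simp

text \<open>The first assumption makes membership in \<open>U\<close> a condition on the coordinates in \<open>T\<close> alone,
  so that multiplication by the other variables never moves a term into the ideal, while the second
  puts all variables of \<open>T\<close> into the radical. Any \<open>g\<close> multiplying some \<open>f\<close> outside the ideal into it turns
  out to lie in the ideal generated by the variables of \<open>T\<close>.\<close>
lemma primary_supported_in:
  fixes U :: "('n::finite \<Rightarrow>\<^sub>0 nat) set"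
  assumes mono: "\<And>t t'. \<lbrakk>t \<in> U; \<And>i. i \<in> T \<Longrightarrow> lookup t i \<le> lookup t' i\<rbrakk> \<Longrightarrow> t' \<in> U"
    and powers: "\<And>i. i \<in> T \<Longrightarrow> single i (p i) \<in> U"
    and proper: "0 \<notin> U"
  shows "primary_ideal (supported_in U :: ('n, 'k::field) mpol set)"
  unfolding primary_ideal_def
proof (intro conjI allI impI)
  have "up_closed U"
    unfolding up_closed_def by (auto simp: lookup_add intro: mono)
  then show ideal: "is_ideal (supported_in U :: ('n, 'k) mpol set)"
    by (rule is_ideal_supported_in)
  have "(1 :: ('n, 'k) mpol) \<notin> supported_in U"
    using proper by (simp add: supported_in_def)
  then show "(supported_in U :: ('n, 'k) mpol set) \<noteq> UNIV"
    by blast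
next
  fix f g :: "('n, 'k) mpol"
  assume fg: "f * g \<in> supported_in U \<and> f \<notin> supported_in U"
  define w where "w t = (\<Sum>i\<in>T. lookup t i)" for t :: "'n \<Rightarrow>\<^sub>0 nat"
  have w_add: "w (s + t) = w s + w t" for s t
    by (simp add: w_def lookup_add sum.distrib)
  have w_0: "lookup t i = 0" if "w t = 0" "i \<in> T" for t i
    using that by (simp add: w_def)
  \<comment> \<open>\<open>A\<close> collects the terms of \<open>f\<close> outside the ideal of least degree in the variables of \<open>T\<close>, and
    \<open>B\<close> the terms of \<open>g\<close> free of these variables.\<close>
  define d where "d = (LEAST d. \<exists>a\<in>keys f - U. w a = d)"
  define A where "A = {a \<in> keys f - U. w a = d}"
  define B where "B = {b \<in> keys g. w b = 0}"
  have "keys f - U \<noteq> {}"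
    using fg by (auto simp: supported_in_def)
  then have "\<exists>d. \<exists>a\<in>keys f - U. w a = d"
    by auto
  then have "\<exists>a\<in>keys f - U. w a = d"
    unfolding d_def by (rule LeastI_ex)
  then have "A \<noteq> {}"
    by (auto simp: A_def)
  have d_min: "d \<le> w a" if "a \<in> keys f - U" for a
    unfolding d_def using that by (auto intro: Least_le)
  have fin: "finite A" "finite B"
    by (simp_all add: A_def B_def)
  have "B = {}"
  proof (rule ccontr)
    assume "B \<noteq> {}"
    then obtain a b where ab: "a \<in> A" "b \<in> B"
      and unique: "\<And>a' b'. \<lbrakk>a' \<in> A; b' \<in> B; a' + b' = a + b\<rbrakk> \<Longrightarrow> a' = a"
      using ex_unique_sum[OF fin \<open>A \<noteq> {}\<close>] by blast
    have a: "a \<in> keys f" "a \<notin> U" "w a = d"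
      and b: "b \<in> keys g" "w b = 0"
      using ab by (auto simp: A_def B_def)
    have a_plus_b: "lookup (a + b) i = lookup a i" if "i \<in> T" for i
      using w_0[OF b(2) that] by (simp add: lookup_add)
    have "lookup (f * g) (a + b) = lookup f a * lookup g b"
    proof (rule lookup_mult_unique_sum)
      fix a' b'
      assume *: "a' \<in> keys f" "b' \<in> keys g" "a' + b' = a + b"
      \<comment> \<open>On \<open>T\<close> the exponent \<^term>\<open>a'\<close> is at most \<^term>\<open>a\<close>, so it cannot be in \<open>U\<close>; minimality of
        \<^term>\<open>d\<close> then puts the pair into \<open>A \<times> B\<close>.\<close>
      have "a' \<notin> U"
      proof
        assume "a' \<in> U"
        then have "a \<in> U"
          by (rule mono) (metis "*"(3) a_plus_b le_add1 lookup_add)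
        with a show False by simp
      qed
      moreover have "w a' + w b' = d"
        using * a b by (metis add.right_neutral w_add)
      ultimately have "w a' = d" "w b' = 0"
        using d_min[of a'] * by auto
      then show "a' = a"
        using * \<open>a' \<notin> U\<close> by (intro unique[of a' b']) (auto simp: A_def B_def)
    qed
    moreover have "lookup f a \<noteq> 0" "lookup g b \<noteq> 0"
      using a b by (auto simp: in_keys_iff)
    ultimately have "a + b \<in> keys (f * g)"
      by (simp add: in_keys_iff)
    then have "a + b \<in> U"
      using fg by (auto simp: supported_in_def)
    then have "a \<in> U"
      by (rule mono) (simp add: a_plus_b)
    with a show False by simp
  qed
  then have pos: "0 < (\<Sum>i\<in>T. lookup t i)" if "t \<in> keys g" for t
    using that by (simp add: B_def w_def flip: neq0_conv)
  \<comment> \<open>Pigeonhole: each term of \<open>g ^ r\<close> has degree at least \<open>r\<close> in the variables of \<open>T\<close>, too much for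
    all its exponents to stay below the \<open>p i\<close>. The successor keeps the exponent positive when \<open>T\<close> is
    empty.\<close>
  define r where "r = Suc (\<Sum>i\<in>T. p i)"
  have "keys (g ^ r) \<subseteq> U"
  proof
    fix t
    assume "t \<in> keys (g ^ r)"
    with pos have "r \<le> (\<Sum>i\<in>T. lookup t i)"
      by (rule keys_power_weight)
    then have "(\<Sum>i\<in>T. p i) < (\<Sum>i\<in>T. lookup t i)"
      by (simp add: r_def)
    then obtain i where i: "i \<in> T" "p i < lookup t i"
      by (meson not_le sum_mono)
    show "t \<in> U"
      by (rule mono[OF powers[OF i(1)]]) (use i(2) in \<open>auto simp: lookup_single when_def\<close>)
  qed
  moreover have "0 < r"
    by (simp add: r_def)
  ultimately show "g \<in> radical (supported_in U)"
    unfolding radical_def supported_in_def by blast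
qed

section \<open>The decomposition\<close>

definition component_exponents ::
  "('n::finite \<Rightarrow> nat) set \<Rightarrow> ('n \<Rightarrow> nat) \<Rightarrow> 'n set \<Rightarrow> ('n \<Rightarrow>\<^sub>0 nat) set" where
  "component_exponents E m S =
    {t. \<exists>a\<in>E. \<forall>i. a i \<le> lookup t i + restr m S i} \<union> {t. \<exists>i. i \<notin> S \<and> m i \<le> lookup t i}"

lemma component_eq_supported_in:
  "component (supported_in (multiples E)) m S =
    (supported_in (component_exponents E m S) :: ('n::finite, 'k::comm_ring_1) mpol set)"
proof -
  have "{xvar i ^ m i | i. i \<notin> S}
    = (xpow ` ((\<lambda>i j. if j = i then m i else 0) ` (- S)) :: ('n, 'k) mpol set)"
    by (auto simp: xvar_power_eq_xpow)
  moreover have "multiples ((\<lambda>i j. if j = i then m i else 0) ` (- S))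
    = {t. \<exists>i. i \<notin> S \<and> m i \<le> lookup t i}"
    by (auto simp: multiples_def)
  ultimately show ?thesis
    by (simp add: component_def colon_monomial ideal_gen_monomials supported_in_Un
        component_exponents_def multiples_def lookup_add)
qed

text \<open>The witness for the hard inclusion is the set of coordinates in which \<open>t\<close> reaches the bound
  \<open>m\<close>: there \<open>t\<close> dominates every generator, and elsewhere the pure powers do not divide it.\<close>
lemma multiples_eq_Inter:
  assumes "E \<noteq> {}" and bound: "\<And>a i. a \<in> E \<Longrightarrow> a i \<le> m i"
  shows "multiples E = (\<Inter>S\<in>{S. S \<subset> UNIV}. component_exponents E m S)"
proof
  show "multiples E \<subseteq> (\<Inter>S\<in>{S. S \<subset> UNIV}. component_exponents E m S)"
    by (fastforce simp: multiples_def component_exponents_def intro: trans_le_add1)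
  show "(\<Inter>S\<in>{S. S \<subset> UNIV}. component_exponents E m S) \<subseteq> multiples E"
  proof
    fix t
    assume t: "t \<in> (\<Inter>S\<in>{S. S \<subset> UNIV}. component_exponents E m S)"
    define S where "S = {i. m i \<le> lookup t i}"
    show "t \<in> multiples E"
    proof (cases "S = UNIV")
      case True
      obtain a where "a \<in> E"
        using \<open>E \<noteq> {}\<close> by blast
      with True bound[OF this] have "\<forall>i. a i \<le> lookup t i"
        unfolding S_def by (metis UNIV_I le_trans mem_Collect_eq)
      with \<open>a \<in> E\<close> show ?thesis
        by (auto simp: multiples_def)
    next
      case False
      then have "t \<in> component_exponents E m S"
        using t by blast
      then obtain a where a: "a \<in> E" "\<And>i. a i \<le> lookup t i + restr m S i"
        by (auto simp: component_exponents_def S_def)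
      have "a i \<le> lookup t i" for i
        using a(2)[of i] bound[OF a(1), of i] by (auto simp: restr_def S_def split: if_splits)
      with a(1) show ?thesis
        by (auto simp: multiples_def)
    qed
  qed
qed

text \<open>Translation by \<open>restr m S\<close> satisfies every divisibility condition in the coordinates of \<open>S\<close>, because
  \<open>m\<close> bounds the generators. Only the coordinates outside \<open>S\<close> matter, as the criterion above
  demands; if it fails because the exponent \<open>0\<close> belongs to the set, the ideal contains \<open>1\<close>.\<close>
lemma primary_component:
  fixes E :: "('n::finite \<Rightarrow> nat) set" and S :: "'n set"
  assumes bound: "\<And>a i. a \<in> E \<Longrightarrow> a i \<le> m i"
  shows "primary_ideal (supported_in (component_exponents E m S) :: ('n, 'k::field) mpol set) \<or>
    (supported_in (component_exponents E m S) :: ('n, 'k) mpol set) = UNIV"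
proof -
  have mono: "t' \<in> component_exponents E m S"
    if t: "t \<in> component_exponents E m S" and le: "\<And>i. i \<in> - S \<Longrightarrow> lookup t i \<le> lookup t' i" for t t'
    using t unfolding component_exponents_def
  proof
    assume "t \<in> {t. \<exists>a\<in>E. \<forall>i. a i \<le> lookup t i + restr m S i}"
    then obtain a where a: "a \<in> E" "\<And>i. a i \<le> lookup t i + restr m S i"
      by auto
    have "a i \<le> lookup t' i + restr m S i" for i
      using a(2)[of i] bound[OF a(1), of i] le[of i] by (cases "i \<in> S") (auto simp: restr_def)
    with a(1) show "t' \<in> {t. \<exists>a\<in>E. \<forall>i. a i \<le> lookup t i + restr m S i} \<union>
      {t. \<exists>i. i \<notin> S \<and> m i \<le> lookup t i}"
      by auto
  qed (use le in \<open>force intro: le_trans\<close>)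
  show ?thesis
  proof (cases "0 \<in> component_exponents E m S")
    case True
    then have "component_exponents E m S = UNIV"
      using mono[OF True] by auto
    then show ?thesis
      by (simp add: supported_in_UNIV)
  next
    case False
    have "single i (m i) \<in> component_exponents E m S" if "i \<in> - S" for i
      using that by (auto simp: component_exponents_def)
    then show ?thesis
      using primary_supported_in[of _ "- S" m] mono False by blast
  qed
qed

theorem theorem3p1:
  fixes I :: "('n::finite, 'k::field) mpol set"
    and k :: nat
    and e :: "nat \<Rightarrow> 'n \<Rightarrow> nat"
    and m :: "'n \<Rightarrow> nat"
  assumes "monomial_ideal I"
    and "k \<ge> 1"
    and "minimal_monomial_gens I ((\<lambda>j. xpow (e j)) ` {1..k})"
    and "\<And>i. m i = Max ((\<lambda>j. e j i) ` {1..k})"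
  shows "I = (\<Inter>S\<in>{S. S \<subset> UNIV}. component I m S) \<and>
    (\<forall>S. S \<subset> UNIV \<longrightarrow> primary_ideal (component I m S) \<or> component I m S = UNIV)"
proof -
  define E where "E = e ` {1..k}"
  have "I = ideal_gen (xpow ` E)"
    using assms(3) by (simp add: minimal_monomial_gens_def E_def image_image)
  then have I: "I = supported_in (multiples E)"
    by (simp add: ideal_gen_monomials)
  have bound: "a i \<le> m i" if "a \<in> E" for a i
    using that by (auto simp: E_def assms(4))
  have "E \<noteq> {}"
    using assms(2) by (simp add: E_def)
  have "I = (\<Inter>S\<in>{S. S \<subset> UNIV}. component I m S)"
    unfolding I component_eq_supported_in supported_in_Int[symmetric]
    using multiples_eq_Inter[of E m] \<open>E \<noteq> {}\<close> bound by simp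
  moreover have "primary_ideal (component I m S) \<or> component I m S = UNIV" for S
    unfolding I component_eq_supported_in using bound by (rule primary_component)
  ultimately show ?thesis
    by blast
qed

end
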